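(* The product of arbitrary measures is associative: for any measure spaces $(S,\mathfrak{S},\mu)$, $(T,\mathfrak{T},\nu)$, $(U,\mathfrak{U},\lambda)$, one has $$(\mu\otimes\nu)\otimes\lambda=\mu\otimes(\nu\otimes\lambda)$$ as measures on $\mathfrak{S}\otimes\mathfrak{T}\otimes\mathfrak{U}$, under the usual identification $(S\times T)\times U=S\times(T\times U)=S\times T\times U$.
   Context: A $\sigma$-ring is a family of sets (containing $\emptyset$) closed under countable unions and under differences $A\setminus B$. A measure space $(S,\mathfrak{S},\mu)$ consists of a nonempty set $S$, a $\sigma$-ring $\mathfrak{S}$ of subsets of $S$ ($S\in\mathfrak{S}$ is not required), and a $\sigma$-additive function $\mu\colon\mathfrak{S}\to[0,\infty]$ with $\mu(\emptyset)=0$ (a measure). No $\sigma$-finiteness is assumed. For a measure $\mu$ on $\mathfrak{S}$: $\mathfrak{S}_\mu^\sigma$ is the $\sigma$-ring of all countable unions of sets $A\in\mathfrak{S}$ with $\mu(A)<\infty$ (the $\sigma$-finite sets), and the $\sigma$-finite component $\mu^\sigma$ is the restriction of $\mu$ to $\mathfrak{S}_\mu^\sigma$. For $\sigma$-rings $\mathfrak{S},\mathfrak{T}$, $\mathfrak{S}\otimes\mathfrak{T}$ is the smallest $\sigma$-ring containing $\{A\times B:A\in\mathfrak{S},B\in\mathfrak{T}\}$; this operation is associative under the identification above. When $\mathfrak{S}$ and $\mathfrak{T}$ are generated by sets of finite measure, $\mu\otimes\nu$ is the classical (Halmos) product: the unique measure on $\mathfrak{S}\otimes\mathfrak{T}$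 with $(\mu\otimes\nu)(A\times B)=\mu(A)\nu(B)$ for $A\in\mathfrak{S}$, $B\in\mathfrak{T}$ (with $\infty\cdot0=0$). For arbitrary measures $\mu,\nu$, the product $\mu\otimes\nu$ is the unique measure on $\mathfrak{S}\otimes\mathfrak{T}$ whose $\sigma$-finite component (including its domain) is the classical product $\mu^\sigma\otimes\nu^\sigma$ on $\mathfrak{S}_\mu^\sigma\otimes\mathfrak{T}_\nu^\sigma$; equivalently, it equals $\mu^\sigma\otimes\nu^\sigma$ on $\mathfrak{S}_\mu^\sigma\otimes\mathfrak{T}_\nu^\sigma$ and $\infty$ on all other members of $\mathfrak{S}\otimes\mathfrak{T}$. *)

theory Defs
  imports "HOL-Analysis.Analysis"
begin

definition sigma_ring :: "'a set set \<Rightarrow> bool" where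
  "sigma_ring R \<longleftrightarrow>
     {} \<in> R \<and>
     (\<forall>C. countable C \<longrightarrow> C \<subseteq> R \<longrightarrow> \<Union>C \<in> R) \<and>
     (\<forall>A\<in>R. \<forall>B\<in>R. A - B \<in> R)"

text \<open>A measure on a \<open>\<sigma>\<close>-ring \<open>R\<close> is represented by a total function on all sets, of which only the
  values on \<open>R\<close> matter; the domain \<open>R\<close> is always carried along explicitly. The library's type of
  measures is not applicable, since there the whole space is always measurable.\<close>

definition measure_on :: "'a set set \<Rightarrow> ('a set \<Rightarrow> ennreal) \<Rightarrow> bool" where
  "measure_on R \<mu> \<longleftrightarrow> sigma_ring R \<and> positive R \<mu> \<and> countably_additive R \<mu>"

definition ring_measure_space :: "'a set \<Rightarrow> 'a set set \<Rightarrow> ('a set \<Rightarrow> ennreal) \<Rightarrow> bool" where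
  "ring_measure_space S R \<mu> \<longleftrightarrow> S \<noteq> {} \<and> R \<subseteq> Pow S \<and> measure_on R \<mu>"

definition sigma_finite_sets :: "'a set set \<Rightarrow> ('a set \<Rightarrow> ennreal) \<Rightarrow> 'a set set" where
  "sigma_finite_sets R \<mu> = {\<Union>C |C. countable C \<and> C \<subseteq> {A \<in> R. \<mu> A < \<infinity>}}"

definition prod_ring :: "'a set set \<Rightarrow> 'b set set \<Rightarrow> ('a \<times> 'b) set set"
    (infixr \<open>\<otimes>\<^sub>\<sigma>\<close> 80) where
  "R \<otimes>\<^sub>\<sigma> T = sigma_ring hull {A \<times> B |A B. A \<in> R \<and> B \<in> T}"

text \<open>The classical (Halmos) product, meaningful when \<open>R\<close> and \<open>T\<close> are generated by their sets of
  finite measure. The value 0 off the product \<open>\<sigma>\<close>-ring, as for \<^const>\<open>emeasure\<close>, only serves to make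
  the total function unique.\<close>

definition classical_product ::
  "'a set set \<Rightarrow> ('a set \<Rightarrow> ennreal) \<Rightarrow> 'b set set \<Rightarrow> ('b set \<Rightarrow> ennreal) \<Rightarrow> ('a \<times> 'b) set \<Rightarrow> ennreal"
where
  "classical_product R \<mu> T \<nu> =
     (THE \<rho>. measure_on (R \<otimes>\<^sub>\<sigma> T) \<rho> \<and>
             (\<forall>A\<in>R. \<forall>B\<in>T. \<rho> (A \<times> B) = \<mu> A * \<nu> B) \<and>
             (\<forall>E. E \<notin> R \<otimes>\<^sub>\<sigma> T \<longrightarrow> \<rho> E = 0))"

text \<open>The product of arbitrary measures: the measure on \<open>R \<otimes>\<^sub>\<sigma> T\<close> whose \<open>\<sigma>\<close>-finite component,
  including its domain, is the classical product of the \<open>\<sigma>\<close>-finite components. The restrictions of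
  \<open>\<mu>\<close> and \<open>\<nu>\<close> to their \<open>\<sigma>\<close>-finite sets are expressed by passing the smaller \<open>\<sigma>\<close>-rings.\<close>

definition product_measure ::
  "'a set set \<Rightarrow> ('a set \<Rightarrow> ennreal) \<Rightarrow> 'b set set \<Rightarrow> ('b set \<Rightarrow> ennreal) \<Rightarrow> ('a \<times> 'b) set \<Rightarrow> ennreal"
where
  "product_measure R \<mu> T \<nu> =
     (THE \<rho>. measure_on (R \<otimes>\<^sub>\<sigma> T) \<rho> \<and>
             sigma_finite_sets (R \<otimes>\<^sub>\<sigma> T) \<rho> = sigma_finite_sets R \<mu> \<otimes>\<^sub>\<sigma> sigma_finite_sets T \<nu> \<and>
             (\<forall>E \<in> sigma_finite_sets R \<mu> \<otimes>\<^sub>\<sigma> sigma_finite_sets T \<nu>.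
                \<rho> E = classical_product (sigma_finite_sets R \<mu>) \<mu> (sigma_finite_sets T \<nu>) \<nu> E) \<and>
             (\<forall>E. E \<notin> R \<otimes>\<^sub>\<sigma> T \<longrightarrow> \<rho> E = 0))"

definition reassoc :: "('a \<times> 'b) \<times> 'c \<Rightarrow> 'a \<times> 'b \<times> 'c" where
  "reassoc = (\<lambda>((x, y), z). (x, y, z))"

end

theory Submission
  imports Defs
begin

text \<open>A product measure is \<open>\<infinity>\<close> outside its \<open>\<sigma>\<close>-finite sets. So associativity means that the two
  iterated products have the same \<open>\<sigma>\<close>-finite sets and agree on them.

  The \<open>\<sigma>\<close>-finite sets of a measure form the \<open>\<sigma>\<close>-ring generated by the sets of finite measure
  (\<open>sigma_finite_sets_eq_hull\<close>). Outside it the measure is \<open>\<infinity>\<close>. By definition, the \<open>\<sigma>\<close>-finite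
  component of a product is the classical product of the \<open>\<sigma>\<close>-finite components, domain included, so
  the \<open>\<sigma>\<close>-finite sets of the two iterated products are \<open>(\<SS>\<^sub>\<sigma> \<otimes> \<TT>\<^sub>\<sigma>) \<otimes> \<UU>\<^sub>\<sigma>\<close> and \<open>\<SS>\<^sub>\<sigma> \<otimes> (\<TT>\<^sub>\<sigma> \<otimes> \<UU>\<^sub>\<sigma>)\<close>,
  where the subscript denotes \<open>\<sigma>\<close>-finite sets. Both are generated by boxes
  (\<open>reassoc_prod_ring\<close>), so reassociation identifies them. On them both measures are determined by
  their values on the boxes whose three sides have finite measure (\<open>measure_on_hull_eqI\<close>), and there
  both values are the product of the three measures.

  The defining properties of both kinds of product have to be shown to have a unique solution. The
  classical product is obtained from Caratheodory's extension theorem, applied to the semiring of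
  rectangles; its countable additivity there comes from integrating sections (\<open>rectangle_measure_UN\<close>). The general
  product exists because the \<open>\<sigma>\<close>-ring \<open>\<SS>\<^sub>\<sigma> \<otimes> \<TT>\<^sub>\<sigma>\<close> is an ideal of \<open>\<SS> \<otimes> \<TT>\<close> (\<open>prod_ring_ideal\<close>), so that
  assigning \<open>\<infinity>\<close> to all other sets keeps countable additivity.\<close>

section \<open>Generated \<open>\<sigma>\<close>-rings\<close>

lemma sigma_ring_empty: "sigma_ring R \<Longrightarrow> {} \<in> R"
  by (simp add: sigma_ring_def)

lemma sigma_ring_Diff: "sigma_ring R \<Longrightarrow> A \<in> R \<Longrightarrow> B \<in> R \<Longrightarrow> A - B \<in> R"
  by (simp add: sigma_ring_def)

lemma sigma_ring_UN:
  assumes "sigma_ring R" "countable I" "\<And>i. i \<in> I \<Longrightarrow> A i \<in> R"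
  shows "(\<Union>i\<in>I. A i) \<in> R"
  using assms unfolding sigma_ring_def by (metis countable_image image_subsetI)

lemma sigma_ring_Un: "sigma_ring R \<Longrightarrow> A \<in> R \<Longrightarrow> B \<in> R \<Longrightarrow> A \<union> B \<in> R"
  using sigma_ring_UN[of R "{A, B}" "\<lambda>X. X"] by auto

lemma sigma_ring_Int: "sigma_ring R \<Longrightarrow> A \<in> R \<Longrightarrow> B \<in> R \<Longrightarrow> A \<inter> B \<in> R"
  using sigma_ring_Diff[of R A "A - B"] sigma_ring_Diff[of R A B] by (simp add: Diff_Diff_Int)

lemma sigma_ringI:
  assumes "{} \<in> R"
    and "\<And>A B. A \<in> R \<Longrightarrow> B \<in> R \<Longrightarrow> A - B \<in> R"
    and "\<And>C. countable C \<Longrightarrow> C \<subseteq> R \<Longrightarrow> \<Union>C \<in> R"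
  shows "sigma_ring R"
  using assms by (simp add: sigma_ring_def)

lemma sigma_ring_hull: "sigma_ring (sigma_ring hull G)"
  by (rule hull_in) (auto simp: sigma_ring_def le_Inf_iff)

text \<open>Most closure properties below are read off from the fact that the sets whose image under a
  map that respects countable unions and differences lies in a \<open>\<sigma>\<close>-ring form a \<open>\<sigma>\<close>-ring: the map
  will be an intersection with a fixed set, a product with a fixed set, or the image under an
  injection.\<close>

lemma hull_mem_if_preserving:
  assumes "sigma_ring H"
    and "h {} = {}"
    and "\<And>A B. h (A - B) = h A - h B"
    and "\<And>C. h (\<Union>C) = (\<Union>A\<in>C. h A)"
    and "\<And>A. A \<in> G \<Longrightarrow> h A \<in> H"
    and "A \<in> sigma_ring hull G"
  shows "h A \<in> H"
proof -
  have "sigma_ring {A. h A \<in> H}"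
  proof (rule sigma_ringI)
    fix C assume "countable C" "C \<subseteq> {A. h A \<in> H}"
    then have "(\<Union>A\<in>C. h A) \<in> H"
      by (intro sigma_ring_UN assms(1)) auto
    then show "\<Union>C \<in> {A. h A \<in> H}" by (simp add: assms(4))
  qed (simp_all add: assms(2,3) sigma_ring_empty sigma_ring_Diff assms(1))
  then have "sigma_ring hull G \<subseteq> {A. h A \<in> H}"
    using assms(5) by (intro hull_minimal) auto
  then show ?thesis using assms(6) by blast
qed

text \<open>Being covered by countably many members of \<open>G\<close> passes to subsets and to countable unions, so
  the sets with this property form a \<open>\<sigma>\<close>-ring.\<close>

lemma hull_countable_cover:
  assumes "E \<in> sigma_ring hull G"
  obtains C where "countable C" "C \<subseteq> G" "E \<subseteq> \<Union>C"
proof -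
  let ?cov = "\<lambda>E. \<exists>C. countable C \<and> C \<subseteq> G \<and> E \<subseteq> \<Union>C"
  have "sigma_ring {E. ?cov E}"
  proof (rule sigma_ringI)
    fix K assume K: "countable K" "K \<subseteq> {E. ?cov E}"
    then have "\<forall>E\<in>K. ?cov E" by blast
    then obtain C where C: "\<And>E. E \<in> K \<Longrightarrow> countable (C E) \<and> C E \<subseteq> G \<and> E \<subseteq> \<Union>(C E)"
      by metis
    have "countable (\<Union>E\<in>K. C E)" using K(1) C by blast
    moreover have "(\<Union>E\<in>K. C E) \<subseteq> G" using C by blast
    moreover have "\<Union>K \<subseteq> \<Union>(\<Union>E\<in>K. C E)"
    proof
      fix x assume "x \<in> \<Union>K"
      then obtain E where "E \<in> K" "x \<in> E" by blast
      then show "x \<in> \<Union>(\<Union>E\<in>K. C E)" using C[of E] by blast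
    qed
    ultimately show "\<Union>K \<in> {E. ?cov E}" by blast
  next
    show "A - B \<in> {E. ?cov E}" if "A \<in> {E. ?cov E}" for A B
      using that by (blast intro: order_trans[OF Diff_subset])
  qed (auto intro: exI[of _ "{}"])
  moreover have "?cov E" if "E \<in> G" for E
    using that by (intro exI[of _ "{E}"]) simp
  then have "G \<subseteq> {E. ?cov E}" by blast
  ultimately have "sigma_ring hull G \<subseteq> {E. ?cov E}"
    by (rule hull_minimal[rotated])
  then show thesis using assms that by blast
qed

text \<open>If intersecting with a generator maps \<open>H\<close> into the \<open>\<sigma>\<close>-ring of \<open>G\<close>, then that \<open>\<sigma>\<close>-ring is
  an ideal of the one generated by \<open>H\<close>: a set inside a member of it is the union of its
  intersections with the countably many generators that cover it.\<close>

lemma hull_ideal: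
  assumes "\<And>X D. X \<in> H \<Longrightarrow> D \<in> G \<Longrightarrow> X \<inter> D \<in> sigma_ring hull G"
    and "E \<in> sigma_ring hull H" "F \<in> sigma_ring hull G" "E \<subseteq> F"
  shows "E \<in> sigma_ring hull G"
proof -
  obtain C where C: "countable C" "C \<subseteq> G" "F \<subseteq> \<Union>C"
    using hull_countable_cover[OF assms(3)] .
  have "E \<inter> D \<in> sigma_ring hull G" if "D \<in> C" for D
    using that C assms(1)
    by (intro hull_mem_if_preserving[where h = "\<lambda>X. X \<inter> D", OF sigma_ring_hull _ _ _ _ assms(2)])
       auto
  then have "(\<Union>D\<in>C. E \<inter> D) \<in> sigma_ring hull G"
    by (intro sigma_ring_UN sigma_ring_hull C(1))
  moreover have "(\<Union>D\<in>C. E \<inter> D) = E" using C(3) assms(4) by blast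
  ultimately show ?thesis by simp
qed

lemma hull_image_mem:
  assumes "inj f" "A \<in> sigma_ring hull G"
  shows "f ` A \<in> sigma_ring hull (image f ` G)"
proof (rule hull_mem_if_preserving[OF sigma_ring_hull _ _ _ _ assms(2)])
  show "f ` (A - B) = f ` A - f ` B" for A B
    by (rule image_set_diff[OF assms(1)])
  show "f ` (\<Union>C) = (\<Union>A\<in>C. f ` A)" for C
    by blast
qed (simp_all add: hull_inc)

lemma hull_image_bij:
  assumes "bij f"
  shows "image f ` (sigma_ring hull G) = sigma_ring hull (image f ` G)"
proof
  show "image f ` (sigma_ring hull G) \<subseteq> sigma_ring hull (image f ` G)"
    using hull_image_mem assms by (auto simp: bij_def)
  show "sigma_ring hull (image f ` G) \<subseteq> image f ` (sigma_ring hull G)"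
  proof
    fix B assume "B \<in> sigma_ring hull (image f ` G)"
    then have "inv f ` B \<in> sigma_ring hull (image (inv f) ` image f ` G)"
      using assms by (intro hull_image_mem bij_is_inj bij_imp_bij_inv)
    moreover have "image (inv f) ` image f ` G = G"
      using assms by (simp add: image_comp comp_def bij_is_inj image_image)
    moreover have "B = f ` inv f ` B"
      using assms by (simp add: image_image bij_is_surj surj_f_inv_f)
    ultimately show "B \<in> image f ` (sigma_ring hull G)" by auto
  qed
qed

lemma prod_ring_mem: "A \<in> R \<Longrightarrow> B \<in> T \<Longrightarrow> A \<times> B \<in> R \<otimes>\<^sub>\<sigma> T"
  unfolding prod_ring_def by (auto intro!: hull_inc)

lemma sigma_ring_prod_ring: "sigma_ring (R \<otimes>\<^sub>\<sigma> T)"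
  unfolding prod_ring_def by (rule sigma_ring_hull)

lemma prod_ring_hull_left:
  "(sigma_ring hull G) \<otimes>\<^sub>\<sigma> T = sigma_ring hull {A \<times> B |A B. A \<in> G \<and> B \<in> T}" (is "_ = ?H")
proof
  have "A \<times> B \<in> ?H" if "A \<in> sigma_ring hull G" "B \<in> T" for A B
    using that(2)
    by (intro hull_mem_if_preserving[where h = "\<lambda>A. A \<times> B", OF sigma_ring_hull _ _ _ _ that(1)])
       (auto intro!: hull_inc)
  then show "(sigma_ring hull G) \<otimes>\<^sub>\<sigma> T \<subseteq> ?H"
    unfolding prod_ring_def by (intro hull_minimal sigma_ring_hull) auto
  show "?H \<subseteq> (sigma_ring hull G) \<otimes>\<^sub>\<sigma> T"
    unfolding prod_ring_def by (intro hull_mono) (auto intro: hull_inc)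
qed

lemma prod_ring_hull_right:
  "R \<otimes>\<^sub>\<sigma> (sigma_ring hull G) = sigma_ring hull {A \<times> B |A B. A \<in> R \<and> B \<in> G}" (is "_ = ?H")
proof
  have "A \<times> B \<in> ?H" if "B \<in> sigma_ring hull G" "A \<in> R" for A B
    using that(2)
    by (intro hull_mem_if_preserving[where h = "\<lambda>B. A \<times> B", OF sigma_ring_hull _ _ _ _ that(1)])
       (auto intro!: hull_inc)
  then show "R \<otimes>\<^sub>\<sigma> (sigma_ring hull G) \<subseteq> ?H"
    unfolding prod_ring_def by (intro hull_minimal sigma_ring_hull) auto
  show "?H \<subseteq> R \<otimes>\<^sub>\<sigma> (sigma_ring hull G)"
    unfolding prod_ring_def by (intro hull_mono) (auto intro: hull_inc)
qed

lemma prod_ring_hull: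
  "(sigma_ring hull G) \<otimes>\<^sub>\<sigma> (sigma_ring hull K) = sigma_ring hull {A \<times> B |A B. A \<in> G \<and> B \<in> K}"
proof -
  have "(sigma_ring hull G) \<otimes>\<^sub>\<sigma> (sigma_ring hull K) = G \<otimes>\<^sub>\<sigma> (sigma_ring hull K)"
    unfolding prod_ring_hull_left by (simp add: prod_ring_def)
  then show ?thesis by (simp only: prod_ring_hull_right)
qed

lemma bij_reassoc: "bij reassoc"
  by (rule bij_betw_byWitness[where f' = "\<lambda>(x, y, z). ((x, y), z)"]) (auto simp: reassoc_def)

lemma reassoc_Times: "reassoc ` ((A \<times> B) \<times> C) = A \<times> (B \<times> C)"
  by (force simp: reassoc_def image_iff)

text \<open>Both iterated products are generated by the boxes with sides in the three \<open>\<sigma>\<close>-rings.\<close>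

lemma reassoc_prod_ring: "image reassoc ` ((R \<otimes>\<^sub>\<sigma> T) \<otimes>\<^sub>\<sigma> U) = R \<otimes>\<^sub>\<sigma> (T \<otimes>\<^sub>\<sigma> U)"
proof -
  have "(R \<otimes>\<^sub>\<sigma> T) \<otimes>\<^sub>\<sigma> U = sigma_ring hull {(A \<times> B) \<times> C |A B C. A \<in> R \<and> B \<in> T \<and> C \<in> U}"
    unfolding prod_ring_def[of R T] prod_ring_hull_left by (rule arg_cong[where f = "\<lambda>G. sigma_ring hull G"]) blast
  moreover have "R \<otimes>\<^sub>\<sigma> (T \<otimes>\<^sub>\<sigma> U) = sigma_ring hull {A \<times> (B \<times> C) |A B C. A \<in> R \<and> B \<in> T \<and> C \<in> U}"
    unfolding prod_ring_def[of T U] prod_ring_hull_right by (rule arg_cong[where f = "\<lambda>G. sigma_ring hull G"]) blast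
  moreover have "image reassoc ` {(A \<times> B) \<times> C |A B C. A \<in> R \<and> B \<in> T \<and> C \<in> U} =
      {A \<times> (B \<times> C) |A B C. A \<in> R \<and> B \<in> T \<and> C \<in> U}"
    by (auto simp: image_iff) (metis reassoc_Times)+
  ultimately show ?thesis by (simp add: hull_image_bij[OF bij_reassoc])
qed

section \<open>Measures on \<open>\<sigma>\<close>-rings and their \<open>\<sigma>\<close>-finite components\<close>

lemma sigma_ring_imp_ring_of_sets: "sigma_ring R \<Longrightarrow> ring_of_sets UNIV R"
  by (intro ring_of_setsI) (auto intro: sigma_ring_empty sigma_ring_Un sigma_ring_Diff)

lemma sigma_algebra_imp_sigma_ring:
  assumes "sigma_algebra \<Omega> M"
  shows "sigma_ring M"
proof -
  interpret sigma_algebra \<Omega> M by fact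
  show ?thesis by (intro sigma_ringI) auto
qed

lemma measure_on_sigma_ring: "measure_on R \<mu> \<Longrightarrow> sigma_ring R"
  by (simp add: measure_on_def)

lemma measure_on_empty: "measure_on R \<mu> \<Longrightarrow> \<mu> {} = 0"
  by (simp add: measure_on_def positive_def)

lemma measure_on_UN:
  fixes A :: "nat \<Rightarrow> 'a set"
  assumes "measure_on R \<mu>" "\<And>i. A i \<in> R" "disjoint_family A"
  shows "\<mu> (\<Union>i. A i) = (\<Sum>i. \<mu> (A i))"
proof -
  have "(\<Union>i. A i) \<in> R"
    using assms by (intro sigma_ring_UN measure_on_sigma_ring) auto
  moreover have "range A \<subseteq> R" using assms(2) by blast
  ultimately show ?thesis
    using assms unfolding measure_on_def countably_additive_def by metis
qed

lemma measure_onI: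
  assumes "sigma_ring R" "\<mu> {} = 0"
    and "\<And>A :: nat \<Rightarrow> 'a set. (\<And>i. A i \<in> R) \<Longrightarrow> disjoint_family A \<Longrightarrow>
      (\<Sum>i. \<mu> (A i)) = \<mu> (\<Union>i. A i)"
  shows "measure_on R \<mu>"
  using assms unfolding measure_on_def positive_def countably_additive_def by blast

lemma measure_on_subset:
  assumes "measure_on R \<mu>" "sigma_ring R'" "R' \<subseteq> R"
  shows "measure_on R' \<mu>"
  using assms by (intro measure_onI) (auto simp: measure_on_empty measure_on_UN subset_eq)

lemma measure_on_mono:
  assumes "measure_on R \<mu>" "A \<in> R" "B \<in> R" "A \<subseteq> B"
  shows "\<mu> A \<le> \<mu> B"
proof -
  interpret ring_of_sets UNIV R
    using assms by (intro sigma_ring_imp_ring_of_sets measure_on_sigma_ring)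
  have "increasing R \<mu>"
    using assms(1) by (metis additive_increasing countably_additive_additive measure_on_def)
  then show ?thesis using assms by (auto simp: increasing_def)
qed

lemma measure_on_Diff:
  assumes "measure_on R \<mu>" "A \<in> R" "B \<in> R" "A \<subseteq> B" "\<mu> B < \<infinity>"
  shows "\<mu> (B - A) = \<mu> B - \<mu> A"
proof -
  interpret ring_of_sets UNIV R
    using assms by (intro sigma_ring_imp_ring_of_sets measure_on_sigma_ring)
  have "additive R \<mu>"
    using assms(1) by (metis countably_additive_additive measure_on_def)
  moreover have "B - A \<in> R" using assms by blast
  ultimately have "\<mu> (A \<union> (B - A)) = \<mu> A + \<mu> (B - A)"
    using assms by (intro additiveD) auto
  moreover have "A \<union> (B - A) = B" using assms by blast
  moreover have "\<mu> A < \<infinity>" using measure_on_mono[OF assms(1-4)] assms(5) by simp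
  ultimately show ?thesis by (simp add: less_top)
qed

text \<open>On the subsets of one generator \<open>D\<close>, of finite measure, this is Dynkin's argument with \<open>D\<close> as
  the whole space. Every member of the \<open>\<sigma>\<close>-ring splits into countably many disjoint pieces, each
  inside a generator.\<close>

lemma measure_on_hull_eqI:
  assumes m: "measure_on (sigma_ring hull G) m" and m': "measure_on (sigma_ring hull G) m'"
    and Int: "Int_stable G"
    and eq: "\<And>D. D \<in> G \<Longrightarrow> m D = m' D" and fin: "\<And>D. D \<in> G \<Longrightarrow> m D < \<infinity>"
    and E: "E \<in> sigma_ring hull G"
  shows "m E = m' E"
proof -
  have sub: "m X = m' X" if D: "D \<in> G" and X: "X \<in> sigma_ring hull G" "X \<subseteq> D" for D X
  proof -
    define K where "K = {Y \<in> G. Y \<subseteq> D}"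
    have K: "K \<subseteq> Pow D" "Int_stable K"
      using Int by (auto simp: K_def Int_stable_def)
    have "X \<inter> D \<in> sigma_sets D K"
    proof (rule hull_mem_if_preserving[where h = "\<lambda>X. X \<inter> D", OF _ _ _ _ _ X(1)])
      show "sigma_ring (sigma_sets D K)"
        using K(1) by (rule sigma_algebra_imp_sigma_ring[OF sigma_algebra_sigma_sets])
      show "A \<inter> D \<in> sigma_sets D K" if "A \<in> G" for A
        using that D Int by (intro sigma_sets.Basic) (auto simp: K_def Int_stable_def)
    qed auto
    then have "X \<in> sigma_sets D K" using X(2) by (simp add: Int_absorb2)
    then have "X \<in> sigma_ring hull G \<and> X \<subseteq> D \<and> m X = m' X"
    proof (induction rule: sigma_sets_induct_disjoint[OF K(2) K(1), consumes 1,
          case_names basic empty compl union])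
      case (basic A)
      then show ?case using eq by (auto simp: K_def intro: hull_inc)
    next
      case empty
      then show ?case
        by (simp add: measure_on_empty[OF m] measure_on_empty[OF m']
            sigma_ring_empty[OF sigma_ring_hull])
    next
      case (compl A)
      have "D \<in> sigma_ring hull G" using D by (rule hull_inc)
      moreover have "m D < \<infinity>" "m' D < \<infinity>" using fin[OF D] eq[OF D] by simp_all
      ultimately show ?case
        using compl(2) eq[OF D]
        by (auto simp: measure_on_Diff[OF m] measure_on_Diff[OF m']
            intro: sigma_ring_Diff[OF sigma_ring_hull])
    next
      case (union A)
      then show ?case
        by (auto simp: measure_on_UN[OF m] measure_on_UN[OF m']
            intro!: sigma_ring_UN[OF sigma_ring_hull])
    qed
    then show ?thesis by simp
  qed
  obtain C where C: "countable C" "C \<subseteq> G" "E \<subseteq> \<Union>C"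
    using hull_countable_cover[OF E] .
  show ?thesis
  proof (cases "C = {}")
    case True
    then show ?thesis using C(3) by (simp add: measure_on_empty[OF m] measure_on_empty[OF m'])
  next
    case False
    define D where "D = from_nat_into C"
    have D: "D i \<in> G" for i
      using from_nat_into[OF False] C(2) by (auto simp: D_def)
    define B where "B i = E \<inter> disjointed D i" for i
    have B: "B i \<in> sigma_ring hull G" for i
      unfolding B_def disjointed_def
      using D E
      by (intro sigma_ring_Int sigma_ring_Diff sigma_ring_UN sigma_ring_hull) (auto intro: hull_inc)
    have disj: "disjoint_family B"
      using disjoint_family_disjointed[of D] by (auto simp: disjoint_family_on_def B_def)
    have "(\<Union>i. D i) = \<Union>C"
      using range_from_nat_into[OF False C(1)] by (simp add: D_def)
    then have "E = (\<Union>i. B i)"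
      using C(3) UN_disjointed_eq[of D] by (auto simp: B_def)
    moreover have "m (B i) = m' (B i)" for i
      using disjointed_subset[of D i] by (intro sub[OF D B, of i i]) (auto simp: B_def)
    ultimately show ?thesis
      using measure_on_UN[OF m B disj] measure_on_UN[OF m' B disj] by simp
  qed
qed

definition finite_measure_sets :: "'a set set \<Rightarrow> ('a set \<Rightarrow> ennreal) \<Rightarrow> 'a set set" where
  "finite_measure_sets R \<mu> = {A \<in> R. \<mu> A < \<infinity>}"

lemma finite_measure_sets_Int:
  assumes "measure_on R \<mu>" "A \<in> R" "B \<in> finite_measure_sets R \<mu>"
  shows "A \<inter> B \<in> finite_measure_sets R \<mu>"
proof -
  have "A \<inter> B \<in> R"
    using assms by (auto simp: finite_measure_sets_def intro: sigma_ring_Int measure_on_sigma_ring)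
  then show ?thesis
    using assms measure_on_mono[OF assms(1), of "A \<inter> B" B]
    by (auto simp: finite_measure_sets_def intro: le_less_trans)
qed

lemma Int_stable_finite_measure_sets:
  assumes "measure_on R \<mu>"
  shows "Int_stable (finite_measure_sets R \<mu>)"
  using finite_measure_sets_Int[OF assms] by (auto simp: Int_stable_def finite_measure_sets_def)

lemma Int_stable_Times:
  assumes "Int_stable G" "Int_stable K"
  shows "Int_stable {A \<times> B |A B. A \<in> G \<and> B \<in> K}"
proof -
  have "\<exists>A B. (A\<^sub>1 \<times> B\<^sub>1) \<inter> (A\<^sub>2 \<times> B\<^sub>2) = A \<times> B \<and> A \<in> G \<and> B \<in> K"
    if "A\<^sub>1 \<in> G" "A\<^sub>2 \<in> G" "B\<^sub>1 \<in> K" "B\<^sub>2 \<in> K" for A\<^sub>1 A\<^sub>2 B\<^sub>1 B\<^sub>2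
    using that assms
    by (intro exI[of _ "A\<^sub>1 \<inter> A\<^sub>2"] exI[of _ "B\<^sub>1 \<inter> B\<^sub>2"]) (simp add: Int_stable_def Times_Int_Times)
  then show ?thesis unfolding Int_stable_def by auto
qed

lemma finite_measure_sets_subset_sigma_finite_sets:
  "finite_measure_sets R \<mu> \<subseteq> sigma_finite_sets R \<mu>"
proof
  fix A assume "A \<in> finite_measure_sets R \<mu>"
  then show "A \<in> sigma_finite_sets R \<mu>"
    unfolding sigma_finite_sets_def finite_measure_sets_def
    by (intro CollectI exI[of _ "{A}"]) auto
qed

lemma sigma_finite_sets_subset: "measure_on R \<mu> \<Longrightarrow> sigma_finite_sets R \<mu> \<subseteq> R"
  unfolding sigma_finite_sets_def measure_on_def sigma_ring_def by blast

text \<open>A member \<open>E\<close> of the generated \<open>\<sigma>\<close>-ring is covered by countably many sets of finite measure,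
  and their intersections with \<open>E\<close> have finite measure again.\<close>

lemma sigma_finite_sets_eq_hull:
  assumes "measure_on R \<mu>"
  shows "sigma_finite_sets R \<mu> = sigma_ring hull (finite_measure_sets R \<mu>)" (is "_ = ?H")
proof
  show "sigma_finite_sets R \<mu> \<subseteq> ?H"
  proof
    fix E assume "E \<in> sigma_finite_sets R \<mu>"
    then obtain C where "countable C" "C \<subseteq> finite_measure_sets R \<mu>" "E = \<Union>C"
      unfolding sigma_finite_sets_def finite_measure_sets_def by blast
    then show "E \<in> ?H"
      using sigma_ring_UN[OF sigma_ring_hull, of C "\<lambda>A. A"] by (auto intro: hull_inc)
  qed
  show "?H \<subseteq> sigma_finite_sets R \<mu>"
  proof
    fix E assume E: "E \<in> ?H"
    have "?H \<subseteq> R"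
      using assms by (intro hull_minimal measure_on_sigma_ring) (auto simp: finite_measure_sets_def)
    obtain C where C: "countable C" "C \<subseteq> finite_measure_sets R \<mu>" "E \<subseteq> \<Union>C"
      using hull_countable_cover[OF E] .
    have "(\<lambda>D. E \<inter> D) ` C \<subseteq> finite_measure_sets R \<mu>"
      using C(2) E \<open>?H \<subseteq> R\<close> finite_measure_sets_Int[OF assms] by blast
    moreover have "E = \<Union>((\<lambda>D. E \<inter> D) ` C)" using C(3) by blast
    moreover have "countable ((\<lambda>D. E \<inter> D) ` C)" using C(1) by simp
    ultimately show "E \<in> sigma_finite_sets R \<mu>"
      unfolding sigma_finite_sets_def finite_measure_sets_def by blast
  qed
qed

lemma sigma_ring_sigma_finite_sets: "measure_on R \<mu> \<Longrightarrow> sigma_ring (sigma_finite_sets R \<mu>)"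
  by (simp add: sigma_finite_sets_eq_hull sigma_ring_hull)

lemma measure_on_sigma_finite_sets: "measure_on R \<mu> \<Longrightarrow> measure_on (sigma_finite_sets R \<mu>) \<mu>"
  by (rule measure_on_subset) (auto simp: sigma_ring_sigma_finite_sets dest: sigma_finite_sets_subset)

lemma not_sigma_finite_imp_infinite:
  assumes "E \<in> R" "E \<notin> sigma_finite_sets R \<mu>"
  shows "\<mu> E = \<infinity>"
proof (rule ccontr)
  assume "\<mu> E \<noteq> \<infinity>"
  then have "E \<in> finite_measure_sets R \<mu>"
    using assms(1) by (simp add: finite_measure_sets_def less_top)
  then show False
    using assms(2) finite_measure_sets_subset_sigma_finite_sets by blast
qed

section \<open>The classical product\<close>

text \<open>This serves twice: it makes the integral available for a measure on a \<open>\<sigma>\<close>-ring, and it extends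
  the product of two measures from the rectangles. The extension need not be unique, so
  only its values on \<open>R\<close> are recorded.\<close>

lemma semiring_measure_extends:
  assumes "semiring_of_sets UNIV R" "positive R \<mu>" "countably_additive R \<mu>"
  obtains M where "R \<subseteq> sets M" "\<And>A. A \<in> R \<Longrightarrow> emeasure M A = \<mu> A"
proof -
  obtain \<mu>' where \<mu>': "\<And>A. A \<in> R \<Longrightarrow> \<mu>' A = \<mu> A" "measure_space UNIV (sigma_sets UNIV R) \<mu>'"
    using semiring_of_sets.caratheodory[OF assms] by blast
  show thesis
  proof
    show "R \<subseteq> sets (measure_of UNIV R \<mu>')" by auto
    show "emeasure (measure_of UNIV R \<mu>') A = \<mu> A" if "A \<in> R" for A
      using \<mu>' that by (subst emeasure_measure_of[OF refl]) (auto simp: measure_space_def)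
  qed
qed

lemma semiring_of_rectangles:
  assumes "sigma_ring R" "sigma_ring T"
  shows "semiring_of_sets UNIV {A \<times> B |A B. A \<in> R \<and> B \<in> T}" (is "semiring_of_sets _ ?G")
proof
  show "{} \<in> ?G"
    using assms[THEN sigma_ring_empty] by blast
next
  fix X Y assume "X \<in> ?G" "Y \<in> ?G"
  then obtain A B A' B' where
    XY: "X = A \<times> B" "Y = A' \<times> B'" "A \<in> R" "B \<in> T" "A' \<in> R" "B' \<in> T"
    by blast
  have sides: "A \<inter> A' \<in> R" "A - A' \<in> R" "B \<inter> B' \<in> T" "B - B' \<in> T"
    using XY assms by (auto intro: sigma_ring_Int sigma_ring_Diff)
  have "X \<inter> Y = (A \<inter> A') \<times> (B \<inter> B')" using XY(1,2) by auto
  then show "X \<inter> Y \<in> ?G" using sides by blast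
  let ?C = "{(A - A') \<times> B, (A \<inter> A') \<times> (B - B')}"
  have "?C \<subseteq> ?G" using sides XY(4) by blast
  moreover have "disjoint ?C" by (auto simp: disjoint_def)
  moreover have "X - Y = \<Union>?C" using XY(1,2) by auto
  ultimately show "\<exists>C\<subseteq>?G. finite C \<and> disjoint C \<and> X - Y = \<Union>C"
    by (intro exI[of _ ?C]) simp
qed simp

text \<open>If \<open>A \<times> B\<close> is the disjoint union of the rectangles \<open>A\<^sub>i \<times> B\<^sub>i\<close>, then for each \<open>x\<close> in \<open>A\<close> the
  sections \<open>B\<^sub>i\<close> with \<open>x \<in> A\<^sub>i\<close> partition \<open>B\<close>. Hence the functions \<open>1\<^bsub>A\<^sub>i\<^esub> \<nu>(B\<^sub>i)\<close> add up to
  \<open>1\<^bsub>A\<^esub> \<nu>(B)\<close>, and integration in \<open>x\<close> gives the claim. The integral is with respect to any extension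
  of \<open>\<mu>\<close> to a \<open>\<sigma>\<close>-algebra.\<close>

lemma rectangle_measure_UN:
  fixes A :: "nat \<Rightarrow> 'a set" and B :: "nat \<Rightarrow> 'b set"
  assumes \<mu>: "measure_on R \<mu>" and \<nu>: "measure_on T \<nu>"
    and mem: "\<And>i. A i \<in> R" "\<And>i. B i \<in> T" "A' \<in> R" "B' \<in> T"
    and disj: "disjoint_family (\<lambda>i. A i \<times> B i)"
    and union: "(\<Union>i. A i \<times> B i) = A' \<times> B'"
  shows "(\<Sum>i. \<mu> (A i) * \<nu> (B i)) = \<mu> A' * \<nu> B'"
proof -
  obtain M where M: "R \<subseteq> sets M" "\<And>A. A \<in> R \<Longrightarrow> emeasure M A = \<mu> A"
    using semiring_measure_extends[of R \<mu>] \<mu> sigma_ring_imp_ring_of_sets[of R]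
    unfolding measure_on_def ring_of_sets_def by blast
  have meas: "A i \<in> sets M" "A' \<in> sets M" for i
    using M(1) mem by auto
  have sections: "(\<Sum>i. \<nu> (B i) * indicator (A i) x) = \<nu> B' * indicator A' x" for x
  proof -
    define Y where "Y i = (if x \<in> A i then B i else {})" for i
    have "Y i \<in> T" for i
      using mem(2) sigma_ring_empty[OF measure_on_sigma_ring[OF \<nu>]] by (simp add: Y_def)
    moreover have "disjoint_family Y"
      using disj by (fastforce simp: disjoint_family_on_def Y_def)
    ultimately have "\<nu> (\<Union>i. Y i) = (\<Sum>i. \<nu> (Y i))"
      by (rule measure_on_UN[OF \<nu>])
    moreover have "(\<Union>i. Y i) = (\<Union>i. A i \<times> B i) `` {x}"
      by (auto simp: Y_def split: if_splits)
    moreover have "(A' \<times> B') `` {x} = (if x \<in> A' then B' else {})" by auto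
    moreover have "\<nu> (Y i) = \<nu> (B i) * indicator (A i) x" for i
      by (simp add: Y_def measure_on_empty[OF \<nu>])
    ultimately show ?thesis
      using union by (simp add: measure_on_empty[OF \<nu>] split: if_splits)
  qed
  have "(\<Sum>i. \<mu> (A i) * \<nu> (B i)) = (\<Sum>i. \<integral>\<^sup>+x. \<nu> (B i) * indicator (A i) x \<partial>M)"
    using meas mem M(2) by (simp add: nn_integral_cmult_indicator mult.commute)
  also have "\<dots> = (\<integral>\<^sup>+x. (\<Sum>i. \<nu> (B i) * indicator (A i) x) \<partial>M)"
    using meas by (intro nn_integral_suminf[symmetric]) simp
  also have "\<dots> = \<mu> A' * \<nu> B'"
    unfolding sections using meas mem M(2) by (simp add: nn_integral_cmult_indicator mult.commute)
  finally show ?thesis .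
qed

lemma ex_classical_product:
  assumes \<mu>: "measure_on R \<mu>" and \<nu>: "measure_on T \<nu>"
  obtains \<rho> where "measure_on (R \<otimes>\<^sub>\<sigma> T) \<rho>"
    "\<And>A B. A \<in> R \<Longrightarrow> B \<in> T \<Longrightarrow> \<rho> (A \<times> B) = \<mu> A * \<nu> B"
    "\<And>E. E \<notin> R \<otimes>\<^sub>\<sigma> T \<Longrightarrow> \<rho> E = 0"
proof -
  define G where "G = {A \<times> B |A B. A \<in> R \<and> B \<in> T}"
  \<comment> \<open>The projections recover the sides of a rectangle, except of an empty one, where both
    expressions vanish.\<close>
  define f where "f X = \<mu> (fst ` X) * \<nu> (snd ` X)" for X
  have f: "f (A \<times> B) = \<mu> A * \<nu> B" for A B
    by (cases "A = {} \<or> B = {}") (auto simp: f_def measure_on_empty[OF \<mu>] measure_on_empty[OF \<nu>])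
  have "countably_additive G f"
    unfolding countably_additive_def
  proof (intro allI impI)
    fix X :: "nat \<Rightarrow> ('a \<times> 'b) set"
    assume X: "range X \<subseteq> G" "disjoint_family X" "(\<Union>i. X i) \<in> G"
    have "\<forall>i. \<exists>A B. X i = A \<times> B \<and> A \<in> R \<and> B \<in> T"
      using X(1) unfolding G_def by blast
    then obtain A B where AB: "\<And>i. X i = A i \<times> B i" "\<And>i. A i \<in> R" "\<And>i. B i \<in> T"
      by metis
    obtain A' B' where AB': "(\<Union>i. X i) = A' \<times> B'" "A' \<in> R" "B' \<in> T"
      using X(3) by (auto simp: G_def)
    have "X = (\<lambda>i. A i \<times> B i)" using AB(1) by auto
    then show "(\<Sum>i. f (X i)) = f (\<Union>i. X i)"
      using rectangle_measure_UN[OF \<mu> \<nu> AB(2,3) AB'(2,3)] X(2) AB'(1) by (simp add: f)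
  qed
  moreover have "positive G f"
    by (simp add: positive_def f_def measure_on_empty[OF \<mu>])
  moreover have "semiring_of_sets UNIV G"
    unfolding G_def using \<mu> \<nu> by (intro semiring_of_rectangles measure_on_sigma_ring)
  ultimately obtain M where M: "G \<subseteq> sets M" "\<And>X. X \<in> G \<Longrightarrow> emeasure M X = f X"
    using semiring_measure_extends by metis
  have "measure_on (sets M) (emeasure M)"
    by (intro measure_onI sigma_algebra_imp_sigma_ring[OF sets.sigma_algebra_axioms])
       (auto intro!: suminf_emeasure)
  moreover have sub: "R \<otimes>\<^sub>\<sigma> T \<subseteq> sets M"
    unfolding prod_ring_def using M(1)
    by (intro hull_minimal sigma_algebra_imp_sigma_ring[OF sets.sigma_algebra_axioms])
       (simp add: G_def)
  ultimately have *: "measure_on (R \<otimes>\<^sub>\<sigma> T) (emeasure M)"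
    by (rule measure_on_subset[OF _ sigma_ring_prod_ring])
  define \<rho> where "\<rho> E = (if E \<in> R \<otimes>\<^sub>\<sigma> T then emeasure M E else 0)" for E
  show thesis
  proof
    show "measure_on (R \<otimes>\<^sub>\<sigma> T) \<rho>"
    proof (rule measure_onI[OF sigma_ring_prod_ring])
      fix E :: "nat \<Rightarrow> ('a \<times> 'b) set"
      assume E: "\<And>i. E i \<in> R \<otimes>\<^sub>\<sigma> T" "disjoint_family E"
      then have "(\<Union>i. E i) \<in> R \<otimes>\<^sub>\<sigma> T"
        by (intro sigma_ring_UN sigma_ring_prod_ring) auto
      then show "(\<Sum>i. \<rho> (E i)) = \<rho> (\<Union>i. E i)"
        using E by (simp add: \<rho>_def measure_on_UN[OF *])
    qed (simp add: \<rho>_def)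
    show "\<rho> (A \<times> B) = \<mu> A * \<nu> B" if "A \<in> R" "B \<in> T" for A B
    proof -
      have "A \<times> B \<in> G" using that by (auto simp: G_def)
      then show ?thesis using that by (simp add: \<rho>_def prod_ring_mem M(2) f)
    qed
  qed (simp add: \<rho>_def)
qed

definition finite_rectangles ::
  "'a set set \<Rightarrow> ('a set \<Rightarrow> ennreal) \<Rightarrow> 'b set set \<Rightarrow> ('b set \<Rightarrow> ennreal) \<Rightarrow> ('a \<times> 'b) set set"
where
  "finite_rectangles R \<mu> T \<nu> =
     {A \<times> B |A B. A \<in> finite_measure_sets R \<mu> \<and> B \<in> finite_measure_sets T \<nu>}"

lemma prod_ring_sigma_finite_sets:
  assumes "measure_on R \<mu>" "measure_on T \<nu>"
  shows "sigma_finite_sets R \<mu> \<otimes>\<^sub>\<sigma> sigma_finite_sets T \<nu> =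
    sigma_ring hull (finite_rectangles R \<mu> T \<nu>)"
  using assms by (simp add: sigma_finite_sets_eq_hull prod_ring_hull finite_rectangles_def)

text \<open>Uniqueness needs \<open>\<sigma>\<close>-finiteness: a measure with the prescribed values on rectangles is
  determined by the rectangles with sides of finite measure, which generate the product of the
  \<open>\<sigma>\<close>-finite sets.\<close>

lemma classical_product_sigma_finite:
  assumes \<mu>: "measure_on R \<mu>" and \<nu>: "measure_on T \<nu>"
  defines "Rs \<equiv> sigma_finite_sets R \<mu>" and "Ts \<equiv> sigma_finite_sets T \<nu>"
  shows measure_on_classical_product:
      "measure_on (Rs \<otimes>\<^sub>\<sigma> Ts) (classical_product Rs \<mu> Ts \<nu>)"
    and classical_product_Times:
      "A \<in> Rs \<Longrightarrow> B \<in> Ts \<Longrightarrow> classical_product Rs \<mu> Ts \<nu> (A \<times> B) = \<mu> A * \<nu> B"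
proof -
  let ?P = "\<lambda>\<rho>. measure_on (Rs \<otimes>\<^sub>\<sigma> Ts) \<rho> \<and> (\<forall>A\<in>Rs. \<forall>B\<in>Ts. \<rho> (A \<times> B) = \<mu> A * \<nu> B) \<and>
    (\<forall>E. E \<notin> Rs \<otimes>\<^sub>\<sigma> Ts \<longrightarrow> \<rho> E = 0)"
  let ?G = "finite_rectangles R \<mu> T \<nu>"
  have gen: "Rs \<otimes>\<^sub>\<sigma> Ts = sigma_ring hull ?G"
    unfolding Rs_def Ts_def by (rule prod_ring_sigma_finite_sets[OF \<mu> \<nu>])
  have G: "\<exists>A\<in>Rs. \<exists>B\<in>Ts. D = A \<times> B \<and> \<mu> A < \<infinity> \<and> \<nu> B < \<infinity>" if "D \<in> ?G" for D
    using that finite_measure_sets_subset_sigma_finite_sets[of R \<mu>]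
      finite_measure_sets_subset_sigma_finite_sets[of T \<nu>]
    unfolding Rs_def Ts_def finite_rectangles_def finite_measure_sets_def by blast
  have "Int_stable ?G"
    unfolding finite_rectangles_def
    by (intro Int_stable_Times Int_stable_finite_measure_sets \<mu> \<nu>)
  note unique = measure_on_hull_eqI[OF _ _ this, folded gen]
  have "\<rho> = \<rho>'" if \<rho>: "?P \<rho>" and \<rho>': "?P \<rho>'" for \<rho> \<rho>'
  proof
    fix E
    show "\<rho> E = \<rho>' E"
    proof (cases "E \<in> Rs \<otimes>\<^sub>\<sigma> Ts")
      case True
      show ?thesis
      proof (rule unique[OF _ _ _ _ True])
        fix D assume "D \<in> ?G"
        then obtain A B where "A \<in> Rs" "B \<in> Ts" "D = A \<times> B" "\<mu> A < \<infinity>" "\<nu> B < \<infinity>"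
          using G by blast
        then show "\<rho> D = \<rho>' D" "\<rho> D < \<infinity>"
          using \<rho> \<rho>' by (auto simp: ennreal_mult_less_top)
      qed (use \<rho> \<rho>' in auto)
    qed (use \<rho> \<rho>' in auto)
  qed
  moreover have "measure_on Rs \<mu>" "measure_on Ts \<nu>"
    unfolding Rs_def Ts_def using \<mu> \<nu> by (auto intro: measure_on_sigma_finite_sets)
  then have "\<exists>\<rho>. ?P \<rho>"
    by (rule ex_classical_product) blast
  ultimately have "?P (classical_product Rs \<mu> Ts \<nu>)"
    unfolding classical_product_def by (intro theI'[of ?P]) blast
  then show "measure_on (Rs \<otimes>\<^sub>\<sigma> Ts) (classical_product Rs \<mu> Ts \<nu>)"
    and "A \<in> Rs \<Longrightarrow> B \<in> Ts \<Longrightarrow> classical_product Rs \<mu> Ts \<nu> (A \<times> B) = \<mu> A * \<nu> B"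
    by auto
qed

section \<open>The product of arbitrary measures\<close>

lemma prod_ring_ideal:
  assumes \<mu>: "measure_on R \<mu>" and \<nu>: "measure_on T \<nu>"
    and E: "E \<in> R \<otimes>\<^sub>\<sigma> T" and F: "F \<in> sigma_finite_sets R \<mu> \<otimes>\<^sub>\<sigma> sigma_finite_sets T \<nu>"
    and "E \<subseteq> F"
  shows "E \<in> sigma_finite_sets R \<mu> \<otimes>\<^sub>\<sigma> sigma_finite_sets T \<nu>"
  unfolding prod_ring_sigma_finite_sets[OF \<mu> \<nu>]
proof (rule hull_ideal[OF _ E[unfolded prod_ring_def] F[unfolded prod_ring_sigma_finite_sets[OF \<mu> \<nu>]] \<open>E \<subseteq> F\<close>])
  fix X D assume "X \<in> {A \<times> B |A B. A \<in> R \<and> B \<in> T}" "D \<in> finite_rectangles R \<mu> T \<nu>"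
  then obtain A B A' B' where XD: "X = A \<times> B" "D = A' \<times> B'" "A \<in> R" "B \<in> T"
    "A' \<in> finite_measure_sets R \<mu>" "B' \<in> finite_measure_sets T \<nu>"
    unfolding finite_rectangles_def by blast
  then have "X \<inter> D = (A \<inter> A') \<times> (B \<inter> B')" by auto
  moreover have "A \<inter> A' \<in> finite_measure_sets R \<mu>" "B \<inter> B' \<in> finite_measure_sets T \<nu>"
    using XD(3-6) finite_measure_sets_Int \<mu> \<nu> by auto
  ultimately have "X \<inter> D \<in> finite_rectangles R \<mu> T \<nu>"
    unfolding finite_rectangles_def by blast
  then show "X \<inter> D \<in> sigma_ring hull (finite_rectangles R \<mu> T \<nu>)"
    by (rule hull_inc)
qed

text \<open>Extending the classical product by \<open>\<infinity>\<close> gives a measure because its domain is an ideal: a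
  disjoint union that lies in the domain has all its parts there. There is no other choice, since a
  set of finite measure belongs to the \<open>\<sigma>\<close>-finite component.\<close>

lemma product_measure_characterization:
  assumes \<mu>: "measure_on R \<mu>" and \<nu>: "measure_on T \<nu>"
  shows "measure_on (R \<otimes>\<^sub>\<sigma> T) (product_measure R \<mu> T \<nu>) \<and>
    sigma_finite_sets (R \<otimes>\<^sub>\<sigma> T) (product_measure R \<mu> T \<nu>) =
      sigma_finite_sets R \<mu> \<otimes>\<^sub>\<sigma> sigma_finite_sets T \<nu> \<and>
    (\<forall>E \<in> sigma_finite_sets R \<mu> \<otimes>\<^sub>\<sigma> sigma_finite_sets T \<nu>. product_measure R \<mu> T \<nu> E =
      classical_product (sigma_finite_sets R \<mu>) \<mu> (sigma_finite_sets T \<nu>) \<nu> E)"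
proof -
  define Rs Ts where "Rs = sigma_finite_sets R \<mu>" and "Ts = sigma_finite_sets T \<nu>"
  let ?c = "classical_product Rs \<mu> Ts \<nu>"
  let ?P = "\<lambda>\<rho>. measure_on (R \<otimes>\<^sub>\<sigma> T) \<rho> \<and> sigma_finite_sets (R \<otimes>\<^sub>\<sigma> T) \<rho> = Rs \<otimes>\<^sub>\<sigma> Ts \<and>
    (\<forall>E \<in> Rs \<otimes>\<^sub>\<sigma> Ts. \<rho> E = ?c E) \<and> (\<forall>E. E \<notin> R \<otimes>\<^sub>\<sigma> T \<longrightarrow> \<rho> E = 0)"
  note c = measure_on_classical_product[OF \<mu> \<nu>, folded Rs_def Ts_def]
  have sub: "Rs \<otimes>\<^sub>\<sigma> Ts \<subseteq> R \<otimes>\<^sub>\<sigma> T"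
    using sigma_finite_sets_subset[OF \<mu>] sigma_finite_sets_subset[OF \<nu>]
    unfolding prod_ring_def Rs_def Ts_def by (intro hull_mono) blast
  define \<rho> where
    "\<rho> E = (if E \<in> Rs \<otimes>\<^sub>\<sigma> Ts then ?c E else if E \<in> R \<otimes>\<^sub>\<sigma> T then \<infinity> else 0)" for E
  have \<rho>: "measure_on (R \<otimes>\<^sub>\<sigma> T) \<rho>"
  proof (rule measure_onI[OF sigma_ring_prod_ring])
    show "\<rho> {} = 0"
      by (simp add: \<rho>_def sigma_ring_empty[OF sigma_ring_prod_ring] measure_on_empty[OF c])
  next
    fix E :: "nat \<Rightarrow> ('a \<times> 'b) set"
    assume E: "\<And>i. E i \<in> R \<otimes>\<^sub>\<sigma> T" "disjoint_family E"
    have U: "(\<Union>i. E i) \<in> R \<otimes>\<^sub>\<sigma> T"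
      using E(1) by (intro sigma_ring_UN sigma_ring_prod_ring) auto
    show "(\<Sum>i. \<rho> (E i)) = \<rho> (\<Union>i. E i)"
    proof (cases "\<forall>i. E i \<in> Rs \<otimes>\<^sub>\<sigma> Ts")
      case True
      then have "(\<Union>i. E i) \<in> Rs \<otimes>\<^sub>\<sigma> Ts"
        by (intro sigma_ring_UN sigma_ring_prod_ring) auto
      then show ?thesis
        using True measure_on_UN[OF c _ E(2)] by (simp add: \<rho>_def)
    next
      case False
      then obtain j where j: "E j \<notin> Rs \<otimes>\<^sub>\<sigma> Ts" by blast
      then have "(\<Union>i. E i) \<notin> Rs \<otimes>\<^sub>\<sigma> Ts"
        using prod_ring_ideal[OF \<mu> \<nu> E(1)[of j], of "\<Union>i. E i"] unfolding Rs_def Ts_def by blast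
      then have "\<rho> (\<Union>i. E i) = \<infinity>" using U by (simp add: \<rho>_def)
      moreover have "\<rho> (E j) = \<infinity>" using j E(1) by (simp add: \<rho>_def)
      then have "\<infinity> \<le> (\<Sum>i. \<rho> (E i))"
        using sum_le_suminf[of "\<lambda>i. \<rho> (E i)" "{j}"] by simp
      ultimately show ?thesis by (simp add: top_unique)
    qed
  qed
  have sf: "sigma_finite_sets (R \<otimes>\<^sub>\<sigma> T) \<rho> = Rs \<otimes>\<^sub>\<sigma> Ts"
  proof
    have "finite_measure_sets (R \<otimes>\<^sub>\<sigma> T) \<rho> \<subseteq> Rs \<otimes>\<^sub>\<sigma> Ts"
      by (auto simp: finite_measure_sets_def \<rho>_def split: if_splits)
    then show "sigma_finite_sets (R \<otimes>\<^sub>\<sigma> T) \<rho> \<subseteq> Rs \<otimes>\<^sub>\<sigma> Ts"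
      unfolding sigma_finite_sets_eq_hull[OF \<rho>] by (intro hull_minimal sigma_ring_prod_ring)
    have "finite_rectangles R \<mu> T \<nu> \<subseteq> finite_measure_sets (R \<otimes>\<^sub>\<sigma> T) \<rho>"
    proof
      fix X assume "X \<in> finite_rectangles R \<mu> T \<nu>"
      then obtain A B where X: "X = A \<times> B" and AB: "A \<in> Rs" "B \<in> Ts" "\<mu> A < \<infinity>" "\<nu> B < \<infinity>"
        using finite_measure_sets_subset_sigma_finite_sets[of R \<mu>]
          finite_measure_sets_subset_sigma_finite_sets[of T \<nu>]
        unfolding Rs_def Ts_def finite_rectangles_def finite_measure_sets_def by blast
      have "?c (A \<times> B) = \<mu> A * \<nu> B"
        using classical_product_Times[OF \<mu> \<nu>] AB unfolding Rs_def Ts_def by simp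
      then show "X \<in> finite_measure_sets (R \<otimes>\<^sub>\<sigma> T) \<rho>"
        using AB sub prod_ring_mem[OF AB(1,2)]
        by (auto simp: X finite_measure_sets_def \<rho>_def ennreal_mult_less_top)
    qed
    then show "Rs \<otimes>\<^sub>\<sigma> Ts \<subseteq> sigma_finite_sets (R \<otimes>\<^sub>\<sigma> T) \<rho>"
      unfolding sigma_finite_sets_eq_hull[OF \<rho>] Rs_def Ts_def prod_ring_sigma_finite_sets[OF \<mu> \<nu>]
      by (rule hull_mono)
  qed
  have classical: "\<rho> E = ?c E" if "E \<in> Rs \<otimes>\<^sub>\<sigma> Ts" for E
    using that by (simp add: \<rho>_def)
  have zero: "\<rho> E = 0" if "E \<notin> R \<otimes>\<^sub>\<sigma> T" for E
    using that subsetD[OF sub, of E] by (cases "E \<in> Rs \<otimes>\<^sub>\<sigma> Ts") (simp_all add: \<rho>_def)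
  have ex: "?P \<rho>"
    by (intro conjI ballI allI impI \<rho> sf classical zero)
  have unique: "\<rho>' = \<rho>" if "?P \<rho>'" for \<rho>'
  proof
    fix E
    consider "E \<in> Rs \<otimes>\<^sub>\<sigma> Ts" | "E \<in> R \<otimes>\<^sub>\<sigma> T" "E \<notin> Rs \<otimes>\<^sub>\<sigma> Ts" | "E \<notin> R \<otimes>\<^sub>\<sigma> T"
      by blast
    then show "\<rho>' E = \<rho> E"
    proof cases
      case 1
      then show ?thesis using that classical by simp
    next
      case 2
      then have "\<rho>' E = \<infinity>"
        using that by (intro not_sigma_finite_imp_infinite[of E "R \<otimes>\<^sub>\<sigma> T"]) simp_all
      then show ?thesis using 2 by (simp add: \<rho>_def)
    next
      case 3
      then show ?thesis using that zero by simp
    qed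
  qed
  have eq: "product_measure R \<mu> T \<nu> = \<rho>"
    unfolding product_measure_def Rs_def[symmetric] Ts_def[symmetric]
    by (rule the_equality[of ?P, OF ex unique])
  show ?thesis
    unfolding eq Rs_def[symmetric] Ts_def[symmetric] by (intro conjI ballI \<rho> sf classical)
qed

lemmas measure_on_product_measure = product_measure_characterization[THEN conjunct1]
  and sigma_finite_sets_product_measure =
    product_measure_characterization[THEN conjunct2, THEN conjunct1]
  and product_measure_eq_classical_product =
    product_measure_characterization[THEN conjunct2, THEN conjunct2, THEN bspec]

lemma product_measure_Times:
  assumes \<mu>: "measure_on R \<mu>" and \<nu>: "measure_on T \<nu>"
    and A: "A \<in> sigma_finite_sets R \<mu>" and B: "B \<in> sigma_finite_sets T \<nu>"
  shows "product_measure R \<mu> T \<nu> (A \<times> B) = \<mu> A * \<nu> B"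
  by (rule trans[OF product_measure_eq_classical_product[OF \<mu> \<nu> prod_ring_mem[OF A B]]
        classical_product_Times[OF \<mu> \<nu> A B]])

lemma measure_on_bij_image:
  assumes "measure_on R \<mu>" "bij f" "sigma_ring R'" "image f ` R' = R"
  shows "measure_on R' (\<lambda>E. \<mu> (f ` E))"
proof (rule measure_onI[OF assms(3)])
  show "\<mu> (f ` {}) = 0" using assms(1) by (simp add: measure_on_empty)
next
  fix A :: "nat \<Rightarrow> _ set" assume A: "\<And>i. A i \<in> R'" "disjoint_family A"
  have "disjoint_family (\<lambda>i. f ` A i)"
    using A(2) image_Int[OF bij_is_inj[OF assms(2)], symmetric]
    by (simp add: disjoint_family_on_def)
  moreover have "f ` A i \<in> R" for i using A(1) assms(4) by blast
  ultimately show "(\<Sum>i. \<mu> (f ` A i)) = \<mu> (f ` (\<Union>i. A i))"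
    using measure_on_UN[OF assms(1), of "\<lambda>i. f ` A i"] by (simp add: image_UN)
qed

theorem corollary2p6:
  fixes S :: "'a set" and \<SS> :: "'a set set" and \<mu> :: "'a set \<Rightarrow> ennreal"
    and T :: "'b set" and \<TT> :: "'b set set" and \<nu> :: "'b set \<Rightarrow> ennreal"
    and U :: "'c set" and \<UU> :: "'c set set" and \<kappa> :: "'c set \<Rightarrow> ennreal"
  assumes "ring_measure_space S \<SS> \<mu>"
    and "ring_measure_space T \<TT> \<nu>"
    and "ring_measure_space U \<UU> \<kappa>"
  shows "(\<lambda>E. reassoc ` E) ` ((\<SS> \<otimes>\<^sub>\<sigma> \<TT>) \<otimes>\<^sub>\<sigma> \<UU>) = \<SS> \<otimes>\<^sub>\<sigma> (\<TT> \<otimes>\<^sub>\<sigma> \<UU>) \<and>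
    (\<forall>E \<in> (\<SS> \<otimes>\<^sub>\<sigma> \<TT>) \<otimes>\<^sub>\<sigma> \<UU>.
       product_measure (\<SS> \<otimes>\<^sub>\<sigma> \<TT>) (product_measure \<SS> \<mu> \<TT> \<nu>) \<UU> \<kappa> E =
       product_measure \<SS> \<mu> (\<TT> \<otimes>\<^sub>\<sigma> \<UU>) (product_measure \<TT> \<nu> \<UU> \<kappa>) (reassoc ` E))"
proof (intro conjI ballI)
  show "(\<lambda>E. reassoc ` E) ` ((\<SS> \<otimes>\<^sub>\<sigma> \<TT>) \<otimes>\<^sub>\<sigma> \<UU>) = \<SS> \<otimes>\<^sub>\<sigma> (\<TT> \<otimes>\<^sub>\<sigma> \<UU>)"
    by (rule reassoc_prod_ring)
next
  fix E assume E: "E \<in> (\<SS> \<otimes>\<^sub>\<sigma> \<TT>) \<otimes>\<^sub>\<sigma> \<UU>"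
  have \<mu>: "measure_on \<SS> \<mu>" and \<nu>: "measure_on \<TT> \<nu>" and \<kappa>: "measure_on \<UU> \<kappa>"
    using assms by (simp_all add: ring_measure_space_def)
  define Ss Ts Us where "Ss = sigma_finite_sets \<SS> \<mu>" and "Ts = sigma_finite_sets \<TT> \<nu>"
    and "Us = sigma_finite_sets \<UU> \<kappa>"
  note sf_defs = Ss_def Ts_def Us_def
  define l where "l = product_measure (\<SS> \<otimes>\<^sub>\<sigma> \<TT>) (product_measure \<SS> \<mu> \<TT> \<nu>) \<UU> \<kappa>"
  define r where "r = product_measure \<SS> \<mu> (\<TT> \<otimes>\<^sub>\<sigma> \<UU>) (product_measure \<TT> \<nu> \<UU> \<kappa>)"
  note \<mu>\<nu> = measure_on_product_measure[OF \<mu> \<nu>] and \<nu>\<kappa> = measure_on_product_measure[OF \<nu> \<kappa>]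
  note sf_\<mu>\<nu> = sigma_finite_sets_product_measure[OF \<mu> \<nu>, folded sf_defs]
    and sf_\<nu>\<kappa> = sigma_finite_sets_product_measure[OF \<nu> \<kappa>, folded sf_defs]
  note l = measure_on_product_measure[OF \<mu>\<nu> \<kappa>, folded l_def]
    and r = measure_on_product_measure[OF \<mu> \<nu>\<kappa>, folded r_def]
  have sf_l: "sigma_finite_sets ((\<SS> \<otimes>\<^sub>\<sigma> \<TT>) \<otimes>\<^sub>\<sigma> \<UU>) l = (Ss \<otimes>\<^sub>\<sigma> Ts) \<otimes>\<^sub>\<sigma> Us"
    using sigma_finite_sets_product_measure[OF \<mu>\<nu> \<kappa>] sf_\<mu>\<nu> by (simp add: l_def sf_defs)
  have sf_r: "sigma_finite_sets (\<SS> \<otimes>\<^sub>\<sigma> (\<TT> \<otimes>\<^sub>\<sigma> \<UU>)) r = Ss \<otimes>\<^sub>\<sigma> (Ts \<otimes>\<^sub>\<sigma> Us)"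
    using sigma_finite_sets_product_measure[OF \<mu> \<nu>\<kappa>] sf_\<nu>\<kappa> by (simp add: r_def sf_defs)
  have l_box: "l ((A \<times> B) \<times> C) = \<mu> A * \<nu> B * \<kappa> C" if "A \<in> Ss" "B \<in> Ts" "C \<in> Us" for A B C
    using that product_measure_Times[OF \<mu>\<nu> \<kappa>, of "A \<times> B" C] product_measure_Times[OF \<mu> \<nu>, of A B]
      prod_ring_mem[of A Ss B Ts] sf_\<mu>\<nu> by (simp add: l_def sf_defs)
  have r_box: "r (A \<times> B \<times> C) = \<mu> A * \<nu> B * \<kappa> C" if "A \<in> Ss" "B \<in> Ts" "C \<in> Us" for A B C
    using that product_measure_Times[OF \<mu> \<nu>\<kappa>, of A "B \<times> C"] product_measure_Times[OF \<nu> \<kappa>, of B C]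
      prod_ring_mem[of B Ts C Us] sf_\<nu>\<kappa> by (simp add: r_def sf_defs mult.assoc)
  have mem_iff: "reassoc ` E \<in> Ss \<otimes>\<^sub>\<sigma> (Ts \<otimes>\<^sub>\<sigma> Us) \<longleftrightarrow> E \<in> (Ss \<otimes>\<^sub>\<sigma> Ts) \<otimes>\<^sub>\<sigma> Us"
    unfolding reassoc_prod_ring[symmetric]
    by (rule inj_image_mem_iff) (simp add: inj_def inj_image_eq_iff[OF bij_is_inj[OF bij_reassoc]])
  have "l E = r (reassoc ` E)"
  proof (cases "E \<in> (Ss \<otimes>\<^sub>\<sigma> Ts) \<otimes>\<^sub>\<sigma> Us")
    case False
    have "reassoc ` E \<in> \<SS> \<otimes>\<^sub>\<sigma> (\<TT> \<otimes>\<^sub>\<sigma> \<UU>)"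
      using E reassoc_prod_ring by blast
    then have "r (reassoc ` E) = \<infinity>"
      by (rule not_sigma_finite_imp_infinite) (simp add: sf_r mem_iff False)
    moreover have "l E = \<infinity>"
      using E by (rule not_sigma_finite_imp_infinite) (simp add: sf_l False)
    ultimately show ?thesis by simp
  next
    case True
    define Sf Tf Uf where "Sf = finite_measure_sets \<SS> \<mu>" and "Tf = finite_measure_sets \<TT> \<nu>"
      and "Uf = finite_measure_sets \<UU> \<kappa>"
    note f_defs = Sf_def Tf_def Uf_def
    define G where "G = {D \<times> C |D C. D \<in> finite_rectangles \<SS> \<mu> \<TT> \<nu> \<and> C \<in> Uf}"
    have gen: "(Ss \<otimes>\<^sub>\<sigma> Ts) \<otimes>\<^sub>\<sigma> Us = sigma_ring hull G"
      unfolding sf_defs prod_ring_sigma_finite_sets[OF \<mu> \<nu>] sigma_finite_sets_eq_hull[OF \<kappa>]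
        prod_ring_hull G_def f_defs ..
    have sub: "Sf \<subseteq> Ss" "Tf \<subseteq> Ts" "Uf \<subseteq> Us"
      unfolding sf_defs f_defs by (rule finite_measure_sets_subset_sigma_finite_sets)+
    show ?thesis
    proof (rule measure_on_hull_eqI[of G l "\<lambda>E. r (reassoc ` E)"])
      show "measure_on (sigma_ring hull G) l"
        using measure_on_sigma_finite_sets[OF l] by (simp add: sf_l gen)
      have "measure_on (Ss \<otimes>\<^sub>\<sigma> (Ts \<otimes>\<^sub>\<sigma> Us)) r"
        using measure_on_sigma_finite_sets[OF r] by (simp add: sf_r)
      then show "measure_on (sigma_ring hull G) (\<lambda>E. r (reassoc ` E))"
        by (rule measure_on_bij_image[OF _ bij_reassoc sigma_ring_hull])
           (simp add: gen[symmetric] reassoc_prod_ring)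
      show "Int_stable G"
        unfolding G_def finite_rectangles_def f_defs
        by (intro Int_stable_Times Int_stable_finite_measure_sets \<mu> \<nu> \<kappa>)
      show "E \<in> sigma_ring hull G" using True gen by simp
    next
      fix D assume "D \<in> G"
      then obtain A B C where D: "D = (A \<times> B) \<times> C" "A \<in> Sf" "B \<in> Tf" "C \<in> Uf"
        unfolding G_def finite_rectangles_def f_defs by blast
      then have mem: "A \<in> Ss" "B \<in> Ts" "C \<in> Us" using sub by auto
      have fin: "\<mu> A < \<infinity>" "\<nu> B < \<infinity>" "\<kappa> C < \<infinity>"
        using D by (simp_all add: f_defs finite_measure_sets_def)
      show "l D = r (reassoc ` D)" "l D < \<infinity>"
        unfolding D(1) reassoc_Times l_box[OF mem] r_box[OF mem]
        using fin by (simp_all add: ennreal_mult_less_top)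
    qed
  qed
  then show "product_measure (\<SS> \<otimes>\<^sub>\<sigma> \<TT>) (product_measure \<SS> \<mu> \<TT> \<nu>) \<UU> \<kappa> E =
      product_measure \<SS> \<mu> (\<TT> \<otimes>\<^sub>\<sigma> \<UU>) (product_measure \<TT> \<nu> \<UU> \<kappa>) (reassoc ` E)"
    by (simp add: l_def r_def)
qed

end
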